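(* Let $D$ be a skeletal directed acyclic graph. For any acyclic reorientation $E$ of $D$, the canonical join representation of $E$ in $\mathcal{AR}_D$ is $$E=\bigvee_{\rho\in\delta_\vee(E)}I_\vee(\rho),$$ and the canonical meet representation of $E$ in $\mathcal{AR}_D$ is $$E=\bigwedge_{\rho\in\delta_\wedge(E)}I_\wedge(\rho).$$
   Context: All directed graphs are finite and simple. A reorientation of a directed acyclic graph $D=(V,A)$ is a directed graph with the same underlying undirected graph, encoded by the set of arcs of $D$ that it reverses. $\mathcal{AR}_D$ is the poset of acyclic reorientations of $D$ ordered by inclusion of sets of reversed arcs. The transitive reduction of a directed acyclic graph is obtained by deleting all arcs whose endpoints are connected by a directed path of length at least $2$. A directed graph is a forest if its underlying undirected graph has no cycle. $D$ is vertebrate if the transitive reduction of every induced subgraph of $D$ is a forest; filled if for any directed path $\pi$ in $D$ whose endpoints are joined by an arc of $D$, all arcs joining any two vertices of $\pi$ belong to $D$; skeletal if vertebrate and filled. When $D$ is skeletal, $\mathcal{AR}_D$ is a semidistributive lattice, so canonical join and meet representations exist. A join representation of an element $x$ of a finite lattice $L$ is a subset $J\subseteq L$ with $x=\bigvee J$; it is irredundant if $x\ne\bigvee J'$ for every strict subset $J'\subsetneq J$. Irredundant join representations of $x$ are ordered by $J\le J'$ if for any $y\in J$ there is $y'\in J'$ with $y\le y'$. The canonical join representation of $x$ is the minimal irredundant join representation for this order, when it exists. Canonical meet representations are defined dually. The transitive support of an arc $(u,v)$ of $D$ is the set of vertices appearing along directed paths in $D$ from $u$ to $v$. A rope of $D$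 is a quadruple $(u,v,\nabla,\Delta)$ where $(u,v)\in A$ and $\nabla\sqcup\Delta$ is a partition of the transitive support of $(u,v)$ minus $\{u,v\}$. For an acyclic reorientation $E$ of $D$ and an arc $(u,v)$ of $D$, let $\nabla_{u,v}^E=\{w\in V : (u,w)\in D\setminus E,\ (w,v)\in D\cap E\}$, $\Delta_{u,v}^E=\{w\in V : (u,w)\in D\cap E,\ (w,v)\in D\setminus E\}$, and $\rho_{u,v}^E=(u,v,\nabla_{u,v}^E,\Delta_{u,v}^E)$. Let $\delta_\vee(E)$ (resp. $\delta_\wedge(E)$) be the set of ropes $\rho_{u,v}^E$ for the arcs $(u,v)$ of $D$ that are reversed (resp. not reversed) in the transitive reduction of $E$, i.e. such that $(v,u)$ (resp. $(u,v)$) is an arc of the transitive reduction of $E$. For a rope $\rho=(u,v,\nabla,\Delta)$, let $I_\vee(\rho)$ be the acyclic reorientation of $D$ where an arc $(w,w')$ of $D$ is reversed if and only if $w\in\Delta\cup\{u\}$ and $w'\in\nabla\cup\{v\}$; let $I_\wedge(\rho)$ be the acyclic reorientation of $D$ where an arc $(w,w')$ of $D$ is not reversed if and only if $w\in\nabla\cup\{u\}$ and $w'\in\Delta\cup\{v\}$. *)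

theory Defs
  imports "Graph_Theory.Graph_Theory" "HOL-Algebra.Lattice"
begin

section \<open>Directed acyclic graphs\<close>

text \<open>
  The library constant \<^const>\<open>forest\<close> forbids directed cycles only. In the symmetric digraph
  \<^term>\<open>mk_symmetric G\<close>, a cycle of length 2 traverses the same undirected edge back and forth,
  so the cycles of the underlying undirected graph are those of length at least 3.
\<close>

definition undirected_forest :: "'a pair_pre_digraph \<Rightarrow> bool" where
  "undirected_forest G \<longleftrightarrow>
    \<not> (\<exists>p. pre_digraph.cycle (mk_symmetric G) p \<and> length p \<ge> 3)"

text \<open>
  Directed paths are lists of vertices, so a path of length at least 2 has at least 3 vertices.
\<close>

definition transitive_reduction :: "'a pair_pre_digraph \<Rightarrow> 'a pair_pre_digraph" where
  "transitive_reduction G = \<lparr> pverts = pverts G,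
    parcs = {(u, v) \<in> parcs G.
      \<not> (\<exists>p. vpath p G \<and> hd p = u \<and> last p = v \<and> length p \<ge> 3)} \<rparr>"

definition vertebrate :: "'a pair_pre_digraph \<Rightarrow> bool" where
  "vertebrate D \<longleftrightarrow> (\<forall>H :: 'a pair_pre_digraph.
    induced_subgraph (with_proj H) (with_proj D) \<longrightarrow> undirected_forest (transitive_reduction H))"

text \<open>
  In a directed acyclic graph, an arc joining two vertices of a directed path can only
  point in the direction of that path.
\<close>

definition filled :: "'a pair_pre_digraph \<Rightarrow> bool" where
  "filled D \<longleftrightarrow> (\<forall>p. vpath p D \<and> (hd p, last p) \<in> parcs D \<longrightarrow>
    (\<forall>i j. i < j \<and> j < length p \<longrightarrow> (p ! i, p ! j) \<in> parcs D))"

definition skeletal :: "'a pair_pre_digraph \<Rightarrow> bool" where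
  "skeletal D \<longleftrightarrow> vertebrate D \<and> filled D"


section \<open>Acyclic reorientations\<close>

text \<open>
  A reorientation is represented by the reoriented digraph itself, so that \<^term>\<open>parcs E\<close> is the
  set of arcs of \<open>E\<close>, and not the set of arcs of \<open>D\<close> that \<open>E\<close> reverses. Acyclicity ensures that
  each edge gets only one of its two directions.
\<close>

definition acyclic_reorientation ::
    "'a pair_pre_digraph \<Rightarrow> 'a pair_pre_digraph \<Rightarrow> bool" where
  "acyclic_reorientation D E \<longleftrightarrow> mk_symmetric E = mk_symmetric D \<and> acyclic (parcs E)"

definition reversed_arcs ::
    "'a pair_pre_digraph \<Rightarrow> 'a pair_pre_digraph \<Rightarrow> ('a \<times> 'a) set" where
  "reversed_arcs D E = parcs D - parcs E"

definition reorient ::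
    "'a pair_pre_digraph \<Rightarrow> ('a \<times> 'a) set \<Rightarrow> 'a pair_pre_digraph" where
  "reorient D R = \<lparr> pverts = pverts D, parcs = (parcs D - R) \<union> (parcs D \<inter> R)\<inverse> \<rparr>"

definition AR :: "'a pair_pre_digraph \<Rightarrow> 'a pair_pre_digraph gorder" where
  "AR D = \<lparr> carrier = {E. acyclic_reorientation D E}, eq = (=),
    le = (\<lambda>E F. reversed_arcs D E \<subseteq> reversed_arcs D F) \<rparr>"


section \<open>Canonical representations\<close>

text \<open>
  Joins are expressed by \<^const>\<open>least\<close> rather than by the choice operator behind \<^const>\<open>supr\<close>,
  so that the equation \<open>x = \<Squnion> J\<close> includes the existence of the join.
\<close>

definition join_representation :: "('a, 'b) gorder_scheme \<Rightarrow> 'a \<Rightarrow> 'a set \<Rightarrow> bool" where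
  "join_representation L x J \<longleftrightarrow> J \<subseteq> carrier L \<and> least L x (Upper L J)"

definition irredundant_join_representation ::
    "('a, 'b) gorder_scheme \<Rightarrow> 'a \<Rightarrow> 'a set \<Rightarrow> bool" where
  "irredundant_join_representation L x J \<longleftrightarrow>
    join_representation L x J \<and> (\<forall>J'. J' \<subset> J \<longrightarrow> \<not> join_representation L x J')"

definition join_refines :: "('a, 'b) gorder_scheme \<Rightarrow> 'a set \<Rightarrow> 'a set \<Rightarrow> bool" where
  "join_refines L J J' \<longleftrightarrow> (\<forall>y\<in>J. \<exists>y'\<in>J'. y \<sqsubseteq>\<^bsub>L\<^esub> y')"

definition canonical_join_representation ::
    "('a, 'b) gorder_scheme \<Rightarrow> 'a \<Rightarrow> 'a set \<Rightarrow> bool" where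
  "canonical_join_representation L x J \<longleftrightarrow>
    irredundant_join_representation L x J \<and>
    (\<forall>J'. irredundant_join_representation L x J' \<longrightarrow> join_refines L J J')"

definition canonical_meet_representation ::
    "('a, 'b) gorder_scheme \<Rightarrow> 'a \<Rightarrow> 'a set \<Rightarrow> bool" where
  "canonical_meet_representation L x M \<longleftrightarrow>
    canonical_join_representation (inv_gorder L) x M"


section \<open>Ropes\<close>

type_synonym 'a rope = "'a \<times> 'a \<times> 'a set \<times> 'a set"

definition transitive_support :: "'a pair_pre_digraph \<Rightarrow> 'a \<Rightarrow> 'a \<Rightarrow> 'a set" where
  "transitive_support D u v = \<Union> {set p | p. vpath p D \<and> hd p = u \<and> last p = v}"

definition ropes :: "'a pair_pre_digraph \<Rightarrow> 'a rope set" where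
  "ropes D = {(u, v, N, T). (u, v) \<in> parcs D \<and>
    N \<union> T = transitive_support D u v - {u, v} \<and> N \<inter> T = {}}"

definition nabla :: "'a pair_pre_digraph \<Rightarrow> 'a pair_pre_digraph \<Rightarrow> 'a \<Rightarrow> 'a \<Rightarrow> 'a set" where
  "nabla D E u v = {w \<in> pverts D.
    (u, w) \<in> parcs D - parcs E \<and> (w, v) \<in> parcs D \<inter> parcs E}"

definition delta :: "'a pair_pre_digraph \<Rightarrow> 'a pair_pre_digraph \<Rightarrow> 'a \<Rightarrow> 'a \<Rightarrow> 'a set" where
  "delta D E u v = {w \<in> pverts D.
    (u, w) \<in> parcs D \<inter> parcs E \<and> (w, v) \<in> parcs D - parcs E}"

definition rope_of :: "'a pair_pre_digraph \<Rightarrow> 'a pair_pre_digraph \<Rightarrow> 'a \<Rightarrow> 'a \<Rightarrow> 'a rope" where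
  "rope_of D E u v = (u, v, nabla D E u v, delta D E u v)"

definition delta_join :: "'a pair_pre_digraph \<Rightarrow> 'a pair_pre_digraph \<Rightarrow> 'a rope set" where
  "delta_join D E = {rope_of D E u v | u v.
    (u, v) \<in> parcs D \<and> (v, u) \<in> parcs (transitive_reduction E)}"

definition delta_meet :: "'a pair_pre_digraph \<Rightarrow> 'a pair_pre_digraph \<Rightarrow> 'a rope set" where
  "delta_meet D E = {rope_of D E u v | u v.
    (u, v) \<in> parcs D \<and> (u, v) \<in> parcs (transitive_reduction E)}"

fun I_join :: "'a pair_pre_digraph \<Rightarrow> 'a rope \<Rightarrow> 'a pair_pre_digraph" where
  "I_join D (u, v, N, T) =
    reorient D {(w, w') \<in> parcs D. w \<in> T \<union> {u} \<and> w' \<in> N \<union> {v}}"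

fun I_meet :: "'a pair_pre_digraph \<Rightarrow> 'a rope \<Rightarrow> 'a pair_pre_digraph" where
  "I_meet D (u, v, N, T) =
    reorient D {(w, w') \<in> parcs D. \<not> (w \<in> N \<union> {u} \<and> w' \<in> T \<union> {v})}"

text \<open>
  For a skeletal digraph \<open>D\<close>, the quadruples selected by \<open>delta_join\<close> and \<open>delta_meet\<close> are ropes.
\<close>

lemma transitive_support_eq:
  assumes D: "pair_digraph D" and acyc: "acyclic (parcs D)" and filled: "filled D"
    and uv: "(u, v) \<in> parcs D"
  shows "transitive_support D u v - {u, v} = {w. (u, w) \<in> parcs D \<and> (w, v) \<in> parcs D}"
proof -
  have "pair_wf_digraph D"
    using D by (simp add: pair_digraph_def pair_fin_digraph_def)
  note wellformed' = pair_wf_digraph.wellformed'[OF this]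
  have noloop: "(x, x) \<notin> parcs D" for x
    using acyc by (auto simp: acyclic_def)
  show ?thesis
  proof (intro Set.set_eqI iffI)
    fix w assume "w \<in> transitive_support D u v - {u, v}"
    then obtain p where p: "vpath p D" "hd p = u" "last p = v" "w \<in> set p"
      and w: "w \<noteq> u" "w \<noteq> v"
      by (auto simp: transitive_support_def)
    have ne: "p \<noteq> []" using p(4) by (cases p) simp_all
    obtain i where i: "i < length p" "p ! i = w"
      using p(4) by (auto simp: in_set_conv_nth)
    have 0: "p ! 0 = u" using p(2) ne by (simp add: hd_conv_nth)
    have l: "p ! (length p - 1) = v" using p(3) ne by (simp add: last_conv_nth)
    have "0 < i" using 0 i w by (cases i) auto
    moreover have "i < length p - 1"
      using l i w by (cases "i = length p - 1") auto
    moreover have "\<forall>i j. i < j \<and> j < length p \<longrightarrow> (p ! i, p ! j) \<in> parcs D"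
      using filled[unfolded filled_def, rule_format, of p] p(1,2,3) uv by simp
    ultimately have "(p ! 0, p ! i) \<in> parcs D" "(p ! i, p ! (length p - 1)) \<in> parcs D"
      using i(1) by simp_all
    then show "w \<in> {w. (u, w) \<in> parcs D \<and> (w, v) \<in> parcs D}"
      using 0 l i by simp
  next
    fix w assume "w \<in> {w. (u, w) \<in> parcs D \<and> (w, v) \<in> parcs D}"
    then have w: "(u, w) \<in> parcs D" "(w, v) \<in> parcs D" by auto
    have ne: "w \<noteq> u" "w \<noteq> v" "u \<noteq> v" using w uv noloop by auto
    have "vpath [u, w, v] D"
      using w ne wellformed'(1)[OF w(1)] wellformed'(1)[OF w(2)] wellformed'(2)[OF w(2)]
      by (simp add: vpath_def vwalk_def)
    then have "set [u, w, v] \<subseteq> transitive_support D u v"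
      unfolding transitive_support_def by (intro Union_upper CollectI exI[of _ "[u, w, v]"]) simp
    then show "w \<in> transitive_support D u v - {u, v}"
      using ne by simp
  qed
qed

lemma acyclic_reorientation_flip:
  assumes "acyclic_reorientation D E" and "(x, y) \<in> parcs D"
  shows "(x, y) \<in> parcs E \<longleftrightarrow> (y, x) \<notin> parcs E"
proof -
  have "(x, y) \<in> parcs (mk_symmetric E)"
    using assms by (auto simp: acyclic_reorientation_def parcs_mk_symmetric)
  moreover have "\<not> ((x, y) \<in> parcs E \<and> (y, x) \<in> parcs E)"
    using assms(1) unfolding acyclic_reorientation_def acyclic_def
    by (meson r_into_trancl' trancl_into_trancl)
  ultimately show ?thesis by (auto simp: parcs_mk_symmetric)
qed

lemma transitive_reduction_no_detour:
  assumes E: "acyclic (parcs E)" and verts: "{x, y, w} \<subseteq> pverts E"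
    and xy: "(x, y) \<in> parcs (transitive_reduction E)"
  shows "\<not> ((x, w) \<in> parcs E \<and> (w, y) \<in> parcs E)"
    and "\<not> ((y, w) \<in> parcs E \<and> (w, x) \<in> parcs E)"
proof -
  have arc: "(x, y) \<in> parcs E"
    and no: "\<not> (\<exists>p. vpath p E \<and> hd p = x \<and> last p = y \<and> length p \<ge> 3)"
    using xy by (auto simp: transitive_reduction_def)
  have noloop: "(a, a) \<notin> parcs E" for a
    using E by (auto simp: acyclic_def)
  show "\<not> ((x, w) \<in> parcs E \<and> (w, y) \<in> parcs E)"
  proof
    assume a: "(x, w) \<in> parcs E \<and> (w, y) \<in> parcs E"
    then have "vpath [x, w, y] E"
      using arc noloop verts by (auto simp: vpath_def vwalk_def)
    then show False using no by (auto dest!: spec[of _ "[x, w, y]"])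
  qed
  show "\<not> ((y, w) \<in> parcs E \<and> (w, x) \<in> parcs E)"
  proof
    assume "(y, w) \<in> parcs E \<and> (w, x) \<in> parcs E"
    then have "(x, x) \<in> (parcs E)\<^sup>+"
      using arc by (meson r_into_trancl' trancl_into_trancl)
    then show False using E by (auto simp: acyclic_def)
  qed
qed

lemma rope_of_in_ropes:
  assumes D: "pair_digraph D" "acyclic (parcs D)" "filled D"
    and E: "acyclic_reorientation D E" and uv: "(u, v) \<in> parcs D"
    and red: "(u, v) \<in> parcs (transitive_reduction E) \<or> (v, u) \<in> parcs (transitive_reduction E)"
  shows "rope_of D E u v \<in> ropes D"
proof -
  have "pair_wf_digraph D"
    using D(1) by (simp add: pair_digraph_def pair_fin_digraph_def)
  note wellformed' = pair_wf_digraph.wellformed'[OF this]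
  have acycE: "acyclic (parcs E)" using E by (simp add: acyclic_reorientation_def)
  have "pverts (mk_symmetric (with_proj E)) = pverts (mk_symmetric (with_proj D))"
    using E by (simp add: acyclic_reorientation_def)
  then have verts: "pverts E = pverts D" by simp
  have split: "(u, w) \<in> parcs E \<longleftrightarrow> (w, v) \<notin> parcs E"
    if w: "(u, w) \<in> parcs D" "(w, v) \<in> parcs D" for w
  proof -
    have vs: "{u, v, w} \<subseteq> pverts E" "{v, u, w} \<subseteq> pverts E"
      using w verts by (auto dest: wellformed')
    show ?thesis
      using red transitive_reduction_no_detour[OF acycE vs(1)]
        transitive_reduction_no_detour[OF acycE vs(2)]
        acyclic_reorientation_flip[OF E w(1)] acyclic_reorientation_flip[OF E w(2)]
      by blast
  qed
  have "nabla D E u v \<union> delta D E u v = {w. (u, w) \<in> parcs D \<and> (w, v) \<in> parcs D}"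
    using split by (auto simp: nabla_def delta_def dest: wellformed')
  moreover have "nabla D E u v \<inter> delta D E u v = {}"
    by (auto simp: nabla_def delta_def)
  ultimately show ?thesis
    using transitive_support_eq[OF D uv] uv by (simp add: rope_of_def ropes_def)
qed

lemma delta_join_subset_ropes:
  assumes "pair_digraph D" "acyclic (parcs D)" "skeletal D" "acyclic_reorientation D E"
  shows "delta_join D E \<subseteq> ropes D"
  using assms by (auto simp: delta_join_def skeletal_def intro: rope_of_in_ropes)

lemma delta_meet_subset_ropes:
  assumes "pair_digraph D" "acyclic (parcs D)" "skeletal D" "acyclic_reorientation D E"
  shows "delta_meet D E \<subseteq> ropes D"
  using assms by (auto simp: delta_meet_def skeletal_def intro: rope_of_in_ropes)

end

theory Submission
  imports Defs
begin

text \<open>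
  The underlying graph of a skeletal \<open>D\<close> is chordal: in an induced cycle some arc disappears in the
  transitive reduction, which by filledness yields a chord. Hence an orientation of \<open>D\<close> is acyclic
  as soon as it has no directed triangle, which makes it easy to check that the \<open>I_join D \<rho>\<close> are
  acyclic and that un-reversing an arc of the transitive reduction of \<open>E\<close> preserves acyclicity.
  If \<open>(u, v)\<close> is reversed in the transitive reduction of \<open>E\<close> and \<open>\<rho>\<close> is its rope, then
  \<open>I_join D \<rho>\<close> is the least element below \<open>E\<close> that reverses \<open>(u, v)\<close>. Un-reversing \<open>(u, v)\<close> in
  \<open>E\<close> gives an element that lies above the other joinands and below which every element of the
  interval under \<open>E\<close> lies unless it is above \<open>I_join D \<rho>\<close>; canonicity follows. That \<open>E\<close> is the
  least upper bound uses in addition that the interval of an arc of \<open>D\<close> is a tournament. The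
  statement on meets is the one on joins for the digraph opposite to \<open>D\<close>.
\<close>

section \<open>Canonical join representations\<close>

text \<open>One element \<open>f\<close> serves two purposes for \<open>j\<close>. It bounds the
  other members of \<open>J\<close> but is not above \<open>x\<close>, so \<open>j\<close> cannot be
  dropped. Any join representation of \<open>x\<close> must contain some \<open>y\<close> not below
  \<open>f\<close>, and such a \<open>y\<close> lies above \<open>j\<close>.\<close>

lemma canonical_join_representationI:
  assumes J: "J \<subseteq> carrier L" and x: "least L x (Upper L J)"
    and F: "\<And>j. j \<in> J \<Longrightarrow> \<exists>f \<in> carrier L. \<not> x \<sqsubseteq>\<^bsub>L\<^esub> f \<and>
      (\<forall>i\<in>J. i \<noteq> j \<longrightarrow> i \<sqsubseteq>\<^bsub>L\<^esub> f) \<and>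
      (\<forall>y\<in>carrier L. y \<sqsubseteq>\<^bsub>L\<^esub> x \<longrightarrow> \<not> y \<sqsubseteq>\<^bsub>L\<^esub> f \<longrightarrow> j \<sqsubseteq>\<^bsub>L\<^esub> y)"
  shows "canonical_join_representation L x J"
  unfolding canonical_join_representation_def irredundant_join_representation_def
proof (intro conjI allI impI notI)
  show "join_representation L x J"
    using J x by (simp add: join_representation_def)
next
  fix J' assume "J' \<subset> J" and J': "join_representation L x J'"
  then obtain j where j: "j \<in> J" "j \<notin> J'" "J' \<subseteq> J" by blast
  obtain f where f: "f \<in> carrier L" "\<not> x \<sqsubseteq>\<^bsub>L\<^esub> f" "\<forall>i\<in>J. i \<noteq> j \<longrightarrow> i \<sqsubseteq>\<^bsub>L\<^esub> f"
    using F[OF j(1)] by blast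
  have "f \<in> Upper L J'"
    using f j by (auto simp: Upper_def)
  then show False
    using J' f(2) by (auto simp: join_representation_def least_def)
next
  fix J'
  assume "join_representation L x J' \<and> (\<forall>J''. J'' \<subset> J' \<longrightarrow> \<not> join_representation L x J'')"
  then have J': "J' \<subseteq> carrier L" "least L x (Upper L J')"
    by (auto simp: join_representation_def)
  show "join_refines L J J'"
    unfolding join_refines_def
  proof
    fix j assume "j \<in> J"
    then obtain f where f: "f \<in> carrier L" "\<not> x \<sqsubseteq>\<^bsub>L\<^esub> f"
      "\<forall>y\<in>carrier L. y \<sqsubseteq>\<^bsub>L\<^esub> x \<longrightarrow> \<not> y \<sqsubseteq>\<^bsub>L\<^esub> f \<longrightarrow> j \<sqsubseteq>\<^bsub>L\<^esub> y"
      using F by blast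
    have "f \<notin> Upper L J'"
      using f J'(2) by (auto simp: least_def)
    then obtain y where y: "y \<in> J'" "y \<in> carrier L" "\<not> y \<sqsubseteq>\<^bsub>L\<^esub> f"
      using f(1) by (auto simp: Upper_def)
    have "y \<sqsubseteq>\<^bsub>L\<^esub> x"
      using J'(2) y by (auto simp: least_def Upper_def)
    then show "\<exists>y\<in>J'. j \<sqsubseteq>\<^bsub>L\<^esub> y" using f y by blast
  qed
qed

text \<open>Serves to exchange \<open>inv_gorder (AR D)\<close> for the poset of the opposite
  digraph, as the two orders are compared only on their common carrier.\<close>

lemma canonical_join_representation_cong:
  assumes "carrier L = carrier M"
    and "\<And>x y. x \<in> carrier L \<Longrightarrow> y \<in> carrier L \<Longrightarrow> x \<sqsubseteq>\<^bsub>L\<^esub> y \<longleftrightarrow> x \<sqsubseteq>\<^bsub>M\<^esub> y"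
  shows "canonical_join_representation L x J \<longleftrightarrow> canonical_join_representation M x J"
proof -
  have "Upper L K = Upper M K" for K
    using assms by (auto simp: Upper_def)
  then have rep: "join_representation L x K \<longleftrightarrow> join_representation M x K" for K
    using assms unfolding join_representation_def least_def by (auto simp: Upper_def)
  then have irr: "irredundant_join_representation L x K \<longleftrightarrow> irredundant_join_representation M x K" for K
    by (simp add: irredundant_join_representation_def)
  have sub: "irredundant_join_representation M x K \<Longrightarrow> K \<subseteq> carrier L" for K
    using assms(1) by (auto simp: irredundant_join_representation_def join_representation_def)
  have "join_refines L J K \<longleftrightarrow> join_refines M J K"
    if "irredundant_join_representation M x J" "irredundant_join_representation M x K" for K
    unfolding join_refines_def using assms(2) sub[OF that(1)] sub[OF that(2)] by (meson subsetD)
  then show ?thesis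
    unfolding canonical_join_representation_def irr by blast
qed


section \<open>Walks and cycles\<close>

lemma acyclic_no_short_cycles:
  assumes "acyclic R"
  shows "(a, a) \<notin> R" and "(a, b) \<in> R \<Longrightarrow> (b, a) \<notin> R"
    and "(a, b) \<in> R \<Longrightarrow> (b, c) \<in> R \<Longrightarrow> (c, a) \<notin> R"
proof -
  have no: "(x, x) \<notin> R\<^sup>+" for x using assms by (simp add: acyclic_def)
  show "(a, a) \<notin> R" using no by blast
  show "(b, a) \<notin> R" if "(a, b) \<in> R"
    using no[of a] that by (blast intro: trancl_into_trancl)
  show "(c, a) \<notin> R" if "(a, b) \<in> R" "(b, c) \<in> R"
    using no[of a] that by (blast intro: trancl_into_trancl)
qed

text \<open>The open interval from \<open>a\<close> to \<open>b\<close> in the transitive closure.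
  Its cardinality is a measure twice: over the arcs of \<open>E\<close> in a minimality argument,
  and over the arcs of \<open>D\<close> in an induction.\<close>

definition between :: "'a rel \<Rightarrow> 'a \<Rightarrow> 'a \<Rightarrow> 'a set" where
  "between R a b = {w. (a, w) \<in> R\<^sup>+ \<and> (w, b) \<in> R\<^sup>+}"

text \<open>\<open>c\<close> lies in the large interval but, by acyclicity, in neither of the
  smaller ones.\<close>

lemma card_between_less:
  assumes "finite R" "acyclic R" "(a, c) \<in> R\<^sup>+" "(c, b) \<in> R\<^sup>+"
  shows "card (between R a c) < card (between R a b)"
    and "card (between R c b) < card (between R a b)"
proof -
  have "between R a b \<subseteq> snd ` (R\<^sup>+)"
    by (force simp: between_def)
  then have fin: "finite (between R a b)"
    using assms(1) by (meson finite_imageI finite_subset finite_trancl)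
  have c: "(c, c) \<notin> R\<^sup>+" using assms(2) by (auto simp: acyclic_def)
  have "between R a c \<subset> between R a b" "between R c b \<subset> between R a b"
    using assms(3,4) c by (auto simp: between_def intro: trancl_trans)
  then show "card (between R a c) < card (between R a b)"
    and "card (between R c b) < card (between R a b)"
    using fin by (simp_all add: psubset_card_mono)
qed

lemma vwalk_arcs_nth: "Suc i < length p \<Longrightarrow> (p ! i, p ! Suc i) \<in> set (vwalk_arcs p)"
proof (induction p arbitrary: i rule: vwalk_arcs.induct)
  case (3 x y xs)
  then show ?case by (cases i) auto
qed auto

lemma vwalk_nth_trancl:
  assumes "vwalk p G" "i < j" "j < length p"
  shows "(p ! i, p ! j) \<in> (arcs_ends G)\<^sup>+"
  using assms(2,3)
proof (induction j)
  case (Suc j)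
  have "(p ! j, p ! Suc j) \<in> arcs_ends G"
    using assms(1) vwalk_arcs_nth[OF Suc.prems(2)] by (auto simp: vwalk_def)
  then show ?case
    using Suc by (cases "i = j") (auto intro: trancl_into_trancl)
qed simp

lemma acyclic_vwalk_vpath:
  assumes "acyclic (arcs_ends G)" "vwalk p G"
  shows "vpath p G"
proof -
  have "p ! i \<noteq> p ! j" if "i < j" "j < length p" for i j
    using vwalk_nth_trancl[OF assms(2) that] assms(1) by (auto simp: acyclic_def)
  then have "distinct p"
    unfolding distinct_conv_nth by (metis nat_neq_iff)
  then show ?thesis using assms(2) by (simp add: vpath_def)
qed

text \<open>The prefix stays separate from \<open>q\<close>, so that the position of
  \<open>y\<close> in the new walk is known to be \<open>length p\<close>.\<close>

lemma vwalk_prepend: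
  assumes "pair_wf_digraph D" "(x, y) \<in> (parcs D)\<^sup>+" "vwalk q (with_proj D)" "hd q = y"
  shows "\<exists>p. vwalk (p @ q) (with_proj D) \<and> p \<noteq> [] \<and> hd p = x"
  using assms(2)
proof (induction rule: converse_trancl_induct)
  case (base x)
  have "vwalk ([x] @ q) (with_proj D)"
    using base assms by (auto intro!: vwalk_consI dest: pair_wf_digraph.in_arcsD1)
  then show ?case by (intro exI[of _ "[x]"]) simp
next
  case (step x x')
  then obtain p where p: "vwalk (p @ q) (with_proj D)" "p \<noteq> []" "hd p = x'" by blast
  have "vwalk (x # (p @ q)) (with_proj D)"
    using p step.hyps(1) assms(1) by (intro vwalk_consI) (auto dest: pair_wf_digraph.in_arcsD1)
  then show ?case by (intro exI[of _ "x # p"]) simp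
qed

text \<open>Walks from \<open>x\<close> to \<open>y\<close> and from \<open>y\<close> to
  \<open>z\<close> concatenate to a path by acyclicity. As its endpoints are joined by an arc,
  filledness joins any two of its vertices.\<close>

lemma filled_interpolate:
  assumes D: "pair_wf_digraph D" "acyclic (parcs D)" "filled D"
    and xy: "(x, y) \<in> (parcs D)\<^sup>+" and yz: "(y, z) \<in> (parcs D)\<^sup>+" and xz: "(x, z) \<in> parcs D"
  shows "(x, y) \<in> parcs D" and "(y, z) \<in> parcs D"
proof -
  have "vwalk [z] (with_proj D)"
    using pair_wf_digraph.in_arcsD2[OF D(1) xz] by auto
  from vwalk_prepend[OF D(1) yz this] obtain p where
    p: "vwalk (p @ [z]) (with_proj D)" "p \<noteq> []" "hd p = y" by auto
  then have "hd (p @ [z]) = y" by simp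
  from vwalk_prepend[OF D(1) xy p(1) this] obtain q where
    q: "vwalk (q @ p @ [z]) (with_proj D)" "q \<noteq> []" "hd q = x" by auto
  let ?r = "q @ p @ [z]"
  have "vpath ?r (with_proj D)"
    using q D(2) by (intro acyclic_vwalk_vpath) auto
  moreover have "hd ?r = x" "last ?r = z" using q by auto
  ultimately have *: "\<forall>i j. i < j \<and> j < length ?r \<longrightarrow> (?r ! i, ?r ! j) \<in> parcs D"
    using D(3)[unfolded filled_def, rule_format, of ?r] xz by simp
  have "?r ! 0 = x" "?r ! length q = y" "?r ! (length q + length p) = z"
    using p q by (auto simp: nth_append hd_conv_nth)
  then show "(x, y) \<in> parcs D" and "(y, z) \<in> parcs D"
    using *[rule_format, of 0 "length q"] *[rule_format, of "length q" "length q + length p"] p q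
    by auto
qed

text \<open>\<open>z\<close> is the second vertex of a path with at least three vertices, hence
  different from the last one.\<close>

lemma not_transitive_reductionD:
  assumes "(x, y) \<in> parcs G" "(x, y) \<notin> parcs (transitive_reduction G)"
  obtains z where "(x, z) \<in> parcs G" "(z, y) \<in> (parcs G)\<^sup>+" "z \<noteq> y"
proof -
  obtain p where p: "vpath p (with_proj G)" "hd p = x" "last p = y" "length p \<ge> 3"
    using assms by (auto simp: transitive_reduction_def)
  then have w: "vwalk p (with_proj G)" "p \<noteq> []" "distinct p" by (auto simp: vpath_def)
  have "(p ! 0, p ! Suc 0) \<in> parcs G"
    using vwalk_arcs_nth[of 0 p] w p(4) by (auto simp: vwalk_def)
  moreover have "(p ! Suc 0, p ! (length p - 1)) \<in> (parcs G)\<^sup>+"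
    using vwalk_nth_trancl[OF w(1), of "Suc 0" "length p - 1"] p(4) by simp
  moreover have "p ! Suc 0 \<noteq> p ! (length p - 1)"
    using w(3) p(4) by (auto simp: nth_eq_iff_index_eq)
  ultimately show thesis
    using that p w by (simp add: hd_conv_nth last_conv_nth)
qed

section \<open>Cycles of the underlying undirected graph\<close>

lemma pcas_map_upt:
  "pcas (f k) (map (\<lambda>i. (f i, f (Suc i))) [k..<k + m]) (f (k + m))"
proof (induction m arbitrary: k)
  case (Suc m)
  show ?case using Suc[of "Suc k"] by (simp add: upt_conv_Cons del: upt_Suc)
qed simp

lemma pawalk_verts_map_upt:
  "pawalk_verts (f k) (map (\<lambda>i. (f i, f (Suc i))) [k..<k + m]) = map f [k..<Suc (k + m)]"
proof (induction m arbitrary: k)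
  case (Suc m)
  show ?case using Suc[of "Suc k"] by (simp add: upt_conv_Cons del: upt_Suc)
qed simp

lemma parcs_mk_symmetric_with_proj:
  "parcs (mk_symmetric (with_proj G)) = parcs G \<union> (parcs G)\<inverse>"
proof -
  have "{(fst e, snd e), (snd e, fst e)} = {e, prod.swap e}" for e :: "'a \<times> 'a"
    by (cases e) simp
  then have "parcs (mk_symmetric (with_proj G)) = (\<Union>e\<in>parcs G. {e, prod.swap e})"
    by (simp add: parcs_mk_symmetric)
  also have "\<dots> = parcs G \<union> prod.swap ` parcs G" by blast
  also have "prod.swap ` parcs G = (parcs G)\<inverse>"
    by (auto simp: image_iff split: prod.splits) (metis swap_simp)
  finally show ?thesis .
qed

lemma cycle_not_undirected_forest:
  fixes f :: "nat \<Rightarrow> 'a"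
  assumes n: "n \<ge> 3" "f n = f 0" "inj_on f {..<n}" "f 0 \<in> pverts G"
    and arcs: "\<And>i. i < n \<Longrightarrow> (f i, f (Suc i)) \<in> parcs G \<union> (parcs G)\<inverse>"
  shows "\<not> undirected_forest G"
proof -
  let ?p = "map (\<lambda>i. (f i, f (Suc i))) [0..<n]"
  let ?S = "with_proj (mk_symmetric (with_proj G))"
  have "set ?p \<subseteq> parcs (mk_symmetric (with_proj G))"
  proof
    fix e assume "e \<in> set ?p"
    then obtain i where "i < n" "e = (f i, f (Suc i))" by auto
    then show "e \<in> parcs (mk_symmetric (with_proj G))"
      using arcs[of i] by (auto simp: parcs_mk_symmetric_with_proj)
  qed
  then have "pre_digraph.awalk ?S (f 0) ?p (f 0)"
    using n pcas_map_upt[of f 0 n]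
    by (simp add: pre_digraph.awalk_def cas_with_proj_eq)
  moreover have "distinct (tl (pre_digraph.awalk_verts ?S (f 0) ?p))"
  proof -
    \<comment> \<open>Without its first entry, the vertex list contains \<open>f 0\<close> only
      once, as the final vertex \<open>f n\<close>.\<close>
    have "tl (pawalk_verts (f 0) ?p) = map f ([1..<n] @ [n])"
      using pawalk_verts_map_upt[of f 0 n] n(1) upt_conv_Cons[of 0 n] by simp
    moreover have "f i \<noteq> f 0" if "1 \<le> i" "i < n" for i
      using inj_onD[OF n(3), of i 0] that by auto
    then have "distinct (map f ([1..<n] @ [n]))"
      using n(2) inj_on_subset[OF n(3), of "{1..<n}"]
      by (fastforce simp: distinct_map)
    ultimately show ?thesis by (simp add: awalk_verts_with_proj_eq)
  qed
  moreover have "?p \<noteq> []" "length ?p \<ge> 3" using n by auto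
  ultimately show ?thesis
    unfolding undirected_forest_def pre_digraph.cycle_def by blast
qed

text \<open>The subgraph induced by the vertices of the cycle has a forest as transitive reduction,
  so some edge of the cycle is deleted there. The path that causes the deletion stays inside the
  subgraph, which puts its second vertex \<open>z\<close> on the cycle.\<close>

lemma vertebrate_cycle:
  fixes f :: "nat \<Rightarrow> 'a"
  assumes D: "pair_wf_digraph D" "vertebrate D"
    and n: "n \<ge> 3" "f n = f 0" "inj_on f {..<n}"
    and arcs: "\<And>i. i < n \<Longrightarrow> (f i, f (Suc i)) \<in> parcs D \<union> (parcs D)\<inverse>"
  obtains i x y z where "i < n" "(x, y) \<in> {(f i, f (Suc i)), (f (Suc i), f i)}" "z \<in> f ` {..<n}"
    "z \<noteq> y" "(x, y) \<in> parcs D" "(x, z) \<in> parcs D" "(z, y) \<in> (parcs D)\<^sup>+"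
proof -
  define X where "X = f ` {..<n}"
  define H where "H = \<lparr> pverts = X, parcs = parcs D \<inter> X \<times> X \<rparr>"
  have wfD: "wf_digraph (with_proj D)"
    using D(1) by (auto simp: wf_digraph_def pair_wf_digraph_def)
  have fX: "f i \<in> X" "f (Suc i) \<in> X" if "i < n" for i
    using that n(1,2) by (cases "Suc i = n"; force simp: X_def)+
  have X: "X \<subseteq> pverts D"
    using arcs D(1) by (auto simp: X_def dest: pair_wf_digraph.wellformed')
  have "induced_subgraph (with_proj H) (with_proj D)"
    using X wfD by (auto simp: induced_subgraph_def subgraph_def H_def compatible_def wf_digraph_def)
  then have "undirected_forest (transitive_reduction H)"
    using D(2) by (auto simp: vertebrate_def)
  then obtain i where i: "i < n"
    "(f i, f (Suc i)) \<notin> parcs (transitive_reduction H) \<union> (parcs (transitive_reduction H))\<inverse>"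
    using cycle_not_undirected_forest[OF n, of "transitive_reduction H"] fX n(1)
    by (auto simp: transitive_reduction_def H_def)
  have "(f i, f (Suc i)) \<in> parcs H \<union> (parcs H)\<inverse>"
    using arcs[OF i(1)] fX[OF i(1)] by (auto simp: H_def)
  then obtain x y where xy: "(x, y) \<in> {(f i, f (Suc i)), (f (Suc i), f i)}" "(x, y) \<in> parcs H"
    by blast
  then have "(x, y) \<notin> parcs (transitive_reduction H)" using i(2) by auto
  then obtain z where z: "(x, z) \<in> parcs H" "(z, y) \<in> (parcs H)\<^sup>+" "z \<noteq> y"
    using xy(2) by (auto elim: not_transitive_reductionD)
  have "(z, y) \<in> (parcs D)\<^sup>+"
    using z(2) by (rule trancl_mono) (simp add: H_def)
  then show thesis
    using that[OF i(1) xy(1)] z xy(2) by (auto simp: H_def X_def)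
qed

section \<open>Tournaments and chordality in skeletal digraphs\<close>

text \<open>If \<open>w\<close> and \<open>w'\<close> were not adjacent, some arc
  \<open>(x, y)\<close> of the square \<open>a, w, b, w'\<close> would have a detour through a third
  vertex of the square. Every choice of that vertex needs either an arc between \<open>w\<close> and
  \<open>w'\<close> or the opposite of an arc of \<open>D\<close>.\<close>

lemma skeletal_interval_tournament:
  assumes D: "pair_wf_digraph D" "acyclic (parcs D)" "skeletal D"
    and ab: "(a, b) \<in> parcs D" and w: "(a, w) \<in> parcs D" "(w, b) \<in> parcs D"
    and w': "(a, w') \<in> parcs D" "(w', b) \<in> parcs D" and ne: "w \<noteq> w'"
  shows "(w, w') \<in> parcs D \<or> (w', w) \<in> parcs D"
proof (rule ccontr)
  assume nadj: "\<not> ?thesis"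
  note acyc = acyclic_no_short_cycles[OF D(2)]
  \<comment> \<open>Index 4 repeats \<open>a\<close>, which closes the square.\<close>
  define f where "f = (\<lambda>i. [a, w, b, w', a] ! i)"
  have less4: "{..<4::nat} = {0, 1, 2, 3}" by auto
  have less4': "i < 4 \<Longrightarrow> i = 0 \<or> i = 1 \<or> i = 2 \<or> i = 3" for i :: nat by auto
  have f: "f 0 = a" "f 1 = w" "f 2 = b" "f 3 = w'" "f 4 = a" "f (Suc 0) = w"
    by (simp_all add: f_def)
  have inj: "inj_on f {..<4}"
    using ab w w' ne acyc(1) unfolding less4 by (auto simp: f)
  have arcs: "(f i, f (Suc i)) \<in> parcs D \<union> (parcs D)\<inverse>" if "i < 4" for i
    using less4'[OF that] w w' by (auto simp: f_def)
  obtain i x y z where i: "i < 4" "(x, y) \<in> {(f i, f (Suc i)), (f (Suc i), f i)}"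
    and z: "z \<in> f ` {..<4}" "z \<noteq> y" "(x, y) \<in> parcs D" "(x, z) \<in> parcs D" "(z, y) \<in> (parcs D)\<^sup>+"
    by (rule vertebrate_cycle[OF D(1) _ _ _ inj arcs]) (use D(3) f in \<open>auto simp: skeletal_def\<close>)
  have zy: "(z, y) \<in> parcs D"
    by (rule filled_interpolate(2)[OF D(1,2) _ r_into_trancl[OF z(4)] z(5) z(3)])
      (use D(3) in \<open>simp add: skeletal_def\<close>)
  have "z \<in> {a, w, b, w'}" using z(1) unfolding less4 by (auto simp: f)
  have "(x, y) \<in> {(a, w), (w, b), (w', b), (a, w')}"
    using less4'[OF i(1)] i(2) z(3) acyc(2)[OF w(1)] acyc(2)[OF w(2)]
      acyc(2)[OF w'(1)] acyc(2)[OF w'(2)]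
    by (elim disjE) (auto simp: f_def)
  then consider "x = a" "y = w" | "x = w" "y = b" | "x = w'" "y = b" | "x = a" "y = w'"
    by blast
  then show False
    using \<open>z \<in> {a, w, b, w'}\<close> nadj zy z(2,4) acyc(1) acyc(2)[OF w(1)] acyc(2)[OF w(2)]
      acyc(2)[OF w'(1)] acyc(2)[OF w'(2)]
    by cases blast+
qed

text \<open>A shortest closed walk of \<open>B\<close> is a cycle with at least four vertices and
  without chords. Yet deleting one of its edges in a transitive reduction, together with filledness,
  yields three pairwise adjacent vertices on it.\<close>

lemma skeletal_orientation_acyclic:
  assumes D: "pair_wf_digraph D" "acyclic (parcs D)" "skeletal D"
    and B: "B \<union> B\<inverse> = parcs D \<union> (parcs D)\<inverse>" "B \<inter> B\<inverse> = {}"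
    and tri: "\<And>x y z. (x, y) \<in> B \<Longrightarrow> (y, z) \<in> B \<Longrightarrow> (z, x) \<notin> B"
  shows "acyclic B"
proof (rule ccontr)
  assume "\<not> acyclic B"
  then have "\<exists>n. n > 0 \<and> (\<exists>x. (x, x) \<in> B ^^ n)"
    by (auto simp: acyclic_def trancl_power)
  then obtain n where n: "n > 0" "\<exists>x. (x, x) \<in> B ^^ n"
    and least: "\<And>m x. m > 0 \<Longrightarrow> (x, x) \<in> B ^^ m \<Longrightarrow> n \<le> m"
    unfolding exists_least_iff[of "\<lambda>n. n > 0 \<and> (\<exists>x. (x, x) \<in> B ^^ n)"]
    by (meson not_less)
  then obtain f where f: "f n = f 0" "\<And>i. i < n \<Longrightarrow> (f i, f (Suc i)) \<in> B"
    unfolding relpow_fun_conv by metis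
  have seg: "(f i, f j) \<in> B ^^ (j - i)" if "i \<le> j" "j \<le> n" for i j
    unfolding relpow_fun_conv using that f(2) by (intro exI[of _ "\<lambda>k. f (i + k)"]) auto
  have noloop: "(a, a) \<notin> B" for a using B(2) by blast
  have no2: "(a, b) \<in> B \<Longrightarrow> (b, a) \<notin> B" for a b using B(2) by blast
  have "n \<noteq> 1" using f(1) f(2)[of 0] noloop by auto
  moreover have "n \<noteq> 2"
  proof
    assume "n = 2"
    then have "(f 0, f 1) \<in> B" "(f 1, f 0) \<in> B"
      using f(1) f(2)[of 0] f(2)[of 1] by (simp_all add: numeral_2_eq_2)
    then show False using no2 by blast
  qed
  moreover have "n \<noteq> 3"
  proof
    assume "n = 3"
    then have "(f 0, f 1) \<in> B" "(f 1, f 2) \<in> B" "(f 2, f 0) \<in> B"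
      using f(1) f(2)[of 0] f(2)[of 1] f(2)[of 2] by (simp_all add: numeral_2_eq_2 numeral_3_eq_3)
    then show False using tri by blast
  qed
  ultimately have n4: "n \<ge> 4" using n(1) by linarith
  have inj: "inj_on f {..<n}"
  proof (rule linorder_inj_onI')
    fix i j assume ij: "i \<in> {..<n}" "j \<in> {..<n}" "i < j"
    show "f i \<noteq> f j"
    proof
      assume "f i = f j"
      then have "(f i, f i) \<in> B ^^ (j - i)" using seg[of i j] ij by simp
      then have "n \<le> j - i" using ij by (intro least) auto
      then show False using ij by simp
    qed
  qed
  \<comment> \<open>A chord followed by the stretch of the cycle from its head back to its tail is a
    closed walk, which by minimality has length at least \<open>n\<close>. This forces the chord to
    be an arc of the cycle.\<close>
  have chordless: "j = Suc i \<or> (Suc i = n \<and> j = 0)" if ij: "i < n" "j < n" "(f i, f j) \<in> B" for i j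
  proof (cases "i < j")
    case True
    have "(f i, f j) \<in> B ^^ 1" using ij by simp
    moreover have "(f j, f 0) \<in> B ^^ (n - j)" using seg[of j n] ij f(1) by simp
    moreover have "(f 0, f i) \<in> B ^^ i" using seg[of 0 i] ij by simp
    ultimately have "(f i, f i) \<in> B ^^ (1 + (n - j) + i)" by (meson relpow_trans)
    then have "n \<le> 1 + (n - j) + i" by (intro least) auto
    then show ?thesis using True ij by linarith
  next
    case False
    have "(f i, f j) \<in> B ^^ 1" using ij by simp
    moreover have "(f j, f i) \<in> B ^^ (i - j)" using seg[of j i] ij False by simp
    ultimately have "(f i, f i) \<in> B ^^ (1 + (i - j))" by (meson relpow_trans)
    then have "n \<le> 1 + (i - j)" by (intro least) auto
    then show ?thesis using False ij by linarith
  qed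
  have arcs: "(f i, f (Suc i)) \<in> parcs D \<union> (parcs D)\<inverse>" if "i < n" for i
    using f(2)[OF that] B(1) by blast
  obtain i x y z where i: "i < n" "(x, y) \<in> {(f i, f (Suc i)), (f (Suc i), f i)}"
    and z: "z \<in> f ` {..<n}" "z \<noteq> y" "(x, y) \<in> parcs D" "(x, z) \<in> parcs D" "(z, y) \<in> (parcs D)\<^sup>+"
    by (rule vertebrate_cycle[OF D(1) _ _ f(1) inj arcs]) (use D(3) n4 in \<open>auto simp: skeletal_def\<close>)
  have zy: "(z, y) \<in> parcs D"
    by (rule filled_interpolate(2)[OF D(1,2) _ r_into_trancl[OF z(4)] z(5) z(3)])
      (use D(3) in \<open>simp add: skeletal_def\<close>)
  have "f (Suc i) \<in> f ` {..<n}"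
    using i(1) n f(1) by (cases "Suc i = n") auto
  then have "x \<in> f ` {..<n}" "y \<in> f ` {..<n}" using i by auto
  then obtain j k l where jkl: "x = f j" "j < n" "y = f k" "k < n" "z = f l" "l < n"
    using z(1) by auto
  have adj: "k = Suc j \<or> (Suc j = n \<and> k = 0) \<or> j = Suc k \<or> (Suc k = n \<and> j = 0)"
    if "(f j, f k) \<in> parcs D" "j < n" "k < n" for j k
  proof -
    have "(f j, f k) \<in> B \<or> (f k, f j) \<in> B" using that(1) B(1) by blast
    then show ?thesis using chordless[of j k] chordless[of k j] that(2,3) by blast
  qed
  \<comment> \<open>On a cycle of length at least four, three distinct vertices cannot be pairwise
    consecutive.\<close>
  have "(k = Suc j \<or> (Suc j = n \<and> k = 0) \<or> j = Suc k \<or> (Suc k = n \<and> j = 0))"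
    "(l = Suc j \<or> (Suc j = n \<and> l = 0) \<or> j = Suc l \<or> (Suc l = n \<and> j = 0))"
    "(k = Suc l \<or> (Suc l = n \<and> k = 0) \<or> l = Suc k \<or> (Suc k = n \<and> l = 0))"
    using adj[of j k] adj[of j l] adj[of l k] jkl z(3,4) zy by simp_all
  moreover have "j \<noteq> k" "k \<noteq> l" "j \<noteq> l"
    using jkl z(2-4) zy acyclic_no_short_cycles(1)[OF D(2)] by auto
  ultimately show False
    using n4 by (elim disjE conjE; linarith)
qed


section \<open>Acyclic reorientations of skeletal digraphs\<close>

lemma acyclic_reorientation_iff:
  "acyclic_reorientation D E \<longleftrightarrow> pverts E = pverts D \<and>
    parcs E \<union> (parcs E)\<inverse> = parcs D \<union> (parcs D)\<inverse> \<and> acyclic (parcs E)"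
proof -
  have eq: "G = H \<longleftrightarrow> pverts G = pverts H \<and> parcs G = parcs H" for G H :: "'a pair_pre_digraph"
    by (cases G, cases H) simp
  show ?thesis
    unfolding acyclic_reorientation_def eq parcs_mk_symmetric_with_proj by simp
qed

lemma acyclic_reorientation_adj:
  assumes "acyclic_reorientation D E" "(a, b) \<in> parcs E"
  shows "(a, b) \<in> parcs D \<or> (b, a) \<in> parcs D"
proof -
  have "parcs E \<subseteq> parcs D \<union> (parcs D)\<inverse>"
    using assms(1) unfolding acyclic_reorientation_iff by (metis Un_upper1)
  then show ?thesis using assms(2) by blast
qed

text \<open>The opposite arc would close a directed triangle.\<close>

lemma acyclic_reorientation_trans:
  assumes E: "acyclic_reorientation D E" and "(a, b) \<in> parcs E" "(b, c) \<in> parcs E"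
    and "(a, c) \<in> parcs D \<or> (c, a) \<in> parcs D"
  shows "(a, c) \<in> parcs E"
proof -
  have "acyclic (parcs E)" using E by (simp add: acyclic_reorientation_iff)
  then have "(c, a) \<notin> parcs E" by (rule acyclic_no_short_cycles(3)) fact+
  then show ?thesis
    using assms(4) acyclic_reorientation_flip[OF E, of a c] acyclic_reorientation_flip[OF E, of c a] by blast
qed

text \<open>
  These axioms are invariant under reversing all arcs of \<open>D\<close>, which derives the statement on
  meets from the one on joins.
\<close>

locale skeletal_dag =
  fixes D :: "'a pair_pre_digraph"
  assumes wf: "pair_wf_digraph D" and fin: "finite (parcs D)" and acyc: "acyclic (parcs D)"
    and interpolate: "\<And>x y z. (x, y) \<in> (parcs D)\<^sup>+ \<Longrightarrow> (y, z) \<in> (parcs D)\<^sup>+ \<Longrightarrow>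
      (x, z) \<in> parcs D \<Longrightarrow> (x, y) \<in> parcs D \<and> (y, z) \<in> parcs D"
    and interval_tournament: "\<And>a b w w'. (a, w) \<in> parcs D \<Longrightarrow> (w, b) \<in> parcs D \<Longrightarrow>
      (a, w') \<in> parcs D \<Longrightarrow> (w', b) \<in> parcs D \<Longrightarrow> (a, b) \<in> parcs D \<Longrightarrow> w \<noteq> w' \<Longrightarrow>
      (w, w') \<in> parcs D \<or> (w', w) \<in> parcs D"
    and orientation_acyclic: "\<And>B. B \<union> B\<inverse> = parcs D \<union> (parcs D)\<inverse> \<Longrightarrow> B \<inter> B\<inverse> = {} \<Longrightarrow>
      (\<And>x y z. (x, y) \<in> B \<Longrightarrow> (y, z) \<in> B \<Longrightarrow> (z, x) \<notin> B) \<Longrightarrow> acyclic B"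
begin

lemmas no_short_cycles = acyclic_no_short_cycles[OF acyc]

lemma in_pverts: "(a, b) \<in> parcs D \<Longrightarrow> a \<in> pverts D \<and> b \<in> pverts D"
  using pair_wf_digraph.wellformed'[OF wf] by blast

section \<open>Sets of reversed arcs\<close>

text \<open>By chordality only triangles matter. A transitive triangle of \<open>D\<close> becomes
  cyclic in exactly two ways: its long arc alone is reversed, which \<open>coclosed\<close>
  excludes, or both short arcs are reversed and the long one is not, which \<open>closed\<close>
  excludes.\<close>

lemma acyclic_reorientation_reorient:
  assumes R: "R \<subseteq> parcs D"
    and coclosed: "\<And>a b c. (a, b) \<in> parcs D \<Longrightarrow> (b, c) \<in> parcs D \<Longrightarrow> (a, c) \<in> R \<Longrightarrow>
      (a, b) \<in> R \<or> (b, c) \<in> R"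
    and closed: "\<And>a b c. (a, b) \<in> R \<Longrightarrow> (b, c) \<in> R \<Longrightarrow> (a, c) \<in> parcs D \<Longrightarrow> (a, c) \<in> R"
  shows "acyclic_reorientation D (reorient D R)"
proof -
  define B where "B = (parcs D - R) \<union> R\<inverse>"
  have B: "(x, y) \<in> B \<longleftrightarrow> (x, y) \<in> parcs D \<and> (x, y) \<notin> R \<or> (y, x) \<in> R" for x y
    by (auto simp: B_def)
  have sym: "B \<union> B\<inverse> = parcs D \<union> (parcs D)\<inverse>"
    using R by (auto simp: B_def)
  moreover have "B \<inter> B\<inverse> = {}"
    using R no_short_cycles(2) by (auto simp: B_def)
  \<comment> \<open>The instances run through the six linear orders that \<open>D\<close> can induce
    on the triangle, and through its two cyclic orientations.\<close>
  moreover have "(z, x) \<notin> B" if "(x, y) \<in> B" "(y, z) \<in> B" for x y z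
    using that coclosed[of x y z] coclosed[of y z x] coclosed[of z x y]
      closed[of z y x] closed[of x z y] closed[of y x z]
      no_short_cycles(3)[of x y z] no_short_cycles(3)[of z y x] R
    unfolding B by blast
  ultimately have "acyclic B" by (rule orientation_acyclic)
  moreover have "parcs (reorient D R) = B" "pverts (reorient D R) = pverts D"
    using R by (auto simp: reorient_def B_def)
  ultimately show ?thesis
    using sym by (simp add: acyclic_reorientation_iff)
qed

lemma reversed_arcs_reorient: "R \<subseteq> parcs D \<Longrightarrow> reversed_arcs D (reorient D R) = R"
  using no_short_cycles(2) by (auto simp: reversed_arcs_def reorient_def)

lemma reversed_arcs_I_join:
  "reversed_arcs D (I_join D (u, v, N, T)) =
    {(w, w') \<in> parcs D. w \<in> T \<union> {u} \<and> w' \<in> N \<union> {v}}"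
  unfolding I_join.simps by (rule reversed_arcs_reorient) blast

text \<open>Arcs kept by \<open>E\<close> are kept by \<open>F\<close>. Combined with
  \<open>(v, u)\<close> in \<open>F\<close>, this forces an arc of \<open>F\<close> from
  \<open>v\<close> to each vertex of the delta side and from each vertex of the nabla side to
  \<open>v\<close>. Composing through \<open>v\<close> reverses all arcs from the delta side to the
  nabla side.\<close>

lemma reversed_arcs_I_join_le:
  assumes E: "acyclic_reorientation D E" and F: "acyclic_reorientation D F"
    and sub: "reversed_arcs D F \<subseteq> reversed_arcs D E" and uv: "(u, v) \<in> reversed_arcs D F"
  shows "reversed_arcs D (I_join D (rope_of D E u v)) \<subseteq> reversed_arcs D F"
proof -
  have keep: "(a, b) \<in> parcs F" if "(a, b) \<in> parcs D \<inter> parcs E" for a b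
    using that sub by (auto simp: reversed_arcs_def)
  have vu: "(v, u) \<in> parcs F"
    using uv acyclic_reorientation_flip[OF F] by (auto simp: reversed_arcs_def)
  have delta: "(v, w) \<in> parcs F" if "w \<in> delta D E u v" for w
    using that vu acyclic_reorientation_trans[OF F vu, of w] keep by (auto simp: delta_def)
  have nabla: "(w, v) \<in> parcs F \<and> (w, u) \<in> parcs F" if "w \<in> nabla D E u v" for w
    using that vu acyclic_reorientation_trans[OF F _ vu, of w] keep by (auto simp: nabla_def)
  have "(w', w) \<in> parcs F"
    if w: "(w, w') \<in> parcs D" "w \<in> delta D E u v \<union> {u}" "w' \<in> nabla D E u v \<union> {v}" for w w'
    using w(2,3) delta nabla vu acyclic_reorientation_trans[OF F, of w' v w] w(1) by blast
  then show ?thesis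
    using acyclic_reorientation_flip[OF F]
    unfolding rope_of_def reversed_arcs_I_join by (auto simp: reversed_arcs_def)
qed

text \<open>The reversed arcs go from the delta side with \<open>u\<close> to the nabla side with
  \<open>v\<close>. As these sides are disjoint and, without detours, cover the interval of
  \<open>(u, v)\<close>, the triangle conditions hold.\<close>

lemma I_join_acyclic:
  assumes E: "acyclic_reorientation D E" and uv: "(u, v) \<in> parcs D" "(v, u) \<in> parcs E"
    and no_detour: "\<nexists>w. (v, w) \<in> parcs E \<and> (w, u) \<in> parcs E"
  shows "acyclic_reorientation D (I_join D (rope_of D E u v))"
  unfolding rope_of_def I_join.simps
proof (rule acyclic_reorientation_reorient)
  let ?T = "delta D E u v \<union> {u}" and ?N = "nabla D E u v \<union> {v}"
  let ?R = "{(w, w') \<in> parcs D. w \<in> ?T \<and> w' \<in> ?N}"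
  show "?R \<subseteq> parcs D" by blast
  have flip: "(x, y) \<in> parcs E \<longleftrightarrow> (y, x) \<notin> parcs E" if "(x, y) \<in> parcs D" for x y
    using acyclic_reorientation_flip[OF E that] .
  have disj: "?T \<inter> ?N = {}"
    using uv no_short_cycles(1) by (auto simp: delta_def nabla_def)
  \<comment> \<open>Vacuous, since no two arcs between disjoint sides compose.\<close>
  then show "(a, c) \<in> ?R" if "(a, b) \<in> ?R" "(b, c) \<in> ?R" "(a, c) \<in> parcs D" for a b c
    using that by blast
  show "(a, b) \<in> ?R \<or> (b, c) \<in> ?R"
    if ab: "(a, b) \<in> parcs D" and bc: "(b, c) \<in> parcs D" and ac: "(a, c) \<in> ?R" for a b c
  proof -
    \<comment> \<open>Prolonging to \<open>u\<close> and \<open>v\<close> places \<open>b\<close> in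
      the interval of \<open>(u, v)\<close>, hence on one of the two sides.\<close>
    have "u = a \<or> (u, a) \<in> parcs D" "c = v \<or> (c, v) \<in> parcs D"
      using ac by (auto simp: delta_def nabla_def)
    then have "(u, b) \<in> (parcs D)\<^sup>+" "(b, v) \<in> (parcs D)\<^sup>+"
      using ab bc by (auto intro: trancl_into_trancl)
    then have b: "(u, b) \<in> parcs D" "(b, v) \<in> parcs D"
      using interpolate uv(1) by blast+
    have "b \<in> ?T \<or> b \<in> ?N"
    proof (cases "(u, b) \<in> parcs E")
      case True
      then have "(v, b) \<in> parcs E"
        using acyclic_reorientation_trans[OF E uv(2)] b by blast
      then show ?thesis
        using True b flip[OF b(2)] in_pverts[OF b(2)] by (simp add: delta_def)
    next
      case False
      then have "(b, v) \<in> parcs E" using flip b no_detour by blast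
      then show ?thesis
        using False b in_pverts[OF b(2)] by (simp add: nabla_def)
    qed
    then show ?thesis using ab bc ac by blast
  qed
qed

text \<open>The set of reversed arcs of \<open>E\<close> satisfies both triangle conditions.
  Removing \<open>(u, v)\<close> could break one only on a triangle containing this arc, and then
  the third vertex would be a detour from \<open>v\<close> to \<open>u\<close> in
  \<open>E\<close>.\<close>

lemma unreverse_arc_acyclic:
  assumes E: "acyclic_reorientation D E" and uv: "(u, v) \<in> parcs D" "(v, u) \<in> parcs E"
    and no_detour: "\<nexists>w. (v, w) \<in> parcs E \<and> (w, u) \<in> parcs E"
  shows "acyclic_reorientation D (reorient D (reversed_arcs D E - {(u, v)}))"
proof (rule acyclic_reorientation_reorient)
  let ?R = "reversed_arcs D E - {(u, v)}"
  have rev: "(x, y) \<in> reversed_arcs D E \<longleftrightarrow> (x, y) \<in> parcs D \<and> (y, x) \<in> parcs E" for x y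
    using acyclic_reorientation_flip[OF E] by (auto simp: reversed_arcs_def)
  show "?R \<subseteq> parcs D" by (auto simp: reversed_arcs_def)
  show "(a, b) \<in> ?R \<or> (b, c) \<in> ?R"
    if ab: "(a, b) \<in> parcs D" and bc: "(b, c) \<in> parcs D" and ac: "(a, c) \<in> ?R" for a b c
  proof -
    have ca: "(c, a) \<in> parcs E" "(a, c) \<in> parcs D" using ac rev by auto
    have "(b, a) \<in> parcs E \<or> (c, b) \<in> parcs E"
      using ca acyclic_reorientation_trans[OF E, of a b c] acyclic_reorientation_flip[OF E]
        ab bc by blast
    \<comment> \<open>When \<open>(u, v)\<close> is one of the two short arcs, the other one must be
      reversed.\<close>
    moreover have "(c, b) \<in> parcs E" if "a = u" "b = v"
      using ca that no_detour bc acyclic_reorientation_flip[OF E bc]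
        acyclic_reorientation_trans[OF E, of c a b] uv by blast
    moreover have "(b, a) \<in> parcs E" if "b = u" "c = v"
      using ca that acyclic_reorientation_flip[OF E ab] no_detour by blast
    moreover have "u \<noteq> v" using uv no_short_cycles(1) by blast
    ultimately show ?thesis using rev ab bc by blast
  qed
  show "(a, c) \<in> ?R" if "(a, b) \<in> ?R" "(b, c) \<in> ?R" "(a, c) \<in> parcs D" for a b c
    using that rev acyclic_reorientation_trans[OF E, of c b a] no_detour by blast
qed

text \<open>Detours of length two already decide membership. If there is none, un-reversing
  \<open>(u, v)\<close> preserves acyclicity, whereas any longer detour from \<open>v\<close> to
  \<open>u\<close> would then close a cycle with \<open>(u, v)\<close>.\<close>

lemma transitive_reduction_iff_no_detour:
  assumes E: "acyclic_reorientation D E" and uv: "(u, v) \<in> parcs D"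
  shows "(v, u) \<in> parcs (transitive_reduction E) \<longleftrightarrow>
    (v, u) \<in> parcs E \<and> (\<nexists>w. (v, w) \<in> parcs E \<and> (w, u) \<in> parcs E)"
proof
  have acycE: "acyclic (parcs E)" and verts: "pverts E = pverts D"
    using E by (simp_all add: acyclic_reorientation_iff)
  have "w \<in> pverts E" if "(v, w) \<in> parcs E" for w
    using acyclic_reorientation_adj[OF E that] in_pverts verts by blast
  then show "(v, u) \<in> parcs E \<and> (\<nexists>w. (v, w) \<in> parcs E \<and> (w, u) \<in> parcs E)"
    if "(v, u) \<in> parcs (transitive_reduction E)"
    using that transitive_reduction_no_detour(1)[OF acycE _ that] in_pverts[OF uv] verts
    by (auto simp: transitive_reduction_def)
next
  assume vu: "(v, u) \<in> parcs E \<and> (\<nexists>w. (v, w) \<in> parcs E \<and> (w, u) \<in> parcs E)"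
  have acycE: "acyclic (parcs E)"
    using E by (simp add: acyclic_reorientation_iff)
  define F where "F = reorient D (reversed_arcs D E - {(u, v)})"
  have acycF: "acyclic (parcs F)"
    using unreverse_arc_acyclic[OF E uv] vu by (simp add: F_def acyclic_reorientation_iff)
  have F: "(x, y) \<in> parcs F" if "(x, y) \<in> parcs E" "(x, y) \<noteq> (v, u)" for x y
    using that acyclic_reorientation_adj[OF E that(1)] acyclic_reorientation_flip[OF E]
    by (auto simp: F_def reorient_def reversed_arcs_def)
  show "(v, u) \<in> parcs (transitive_reduction E)"
  proof (rule ccontr)
    assume "(v, u) \<notin> parcs (transitive_reduction E)"
    then obtain z where z: "(v, z) \<in> parcs E" "(z, u) \<in> (parcs E)\<^sup>+" "z \<noteq> u"
      using vu not_transitive_reductionD by metis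
    \<comment> \<open>By acyclicity of \<open>E\<close>, a walk starting at \<open>z\<close> never
      returns to \<open>v\<close>, so it avoids the one arc that changes.\<close>
    have "(z, x) \<in> (parcs F)\<^sup>+" if "(z, x) \<in> (parcs E)\<^sup>+" for x
      using that
    proof (induction rule: trancl_induct)
      case (base x)
      then show ?case using F[of z x] z(1) acyclic_no_short_cycles(1)[OF acycE] by blast
    next
      case (step x y)
      have "x \<noteq> v" using step.hyps(1) z(1) acycE by (auto simp: acyclic_def intro: trancl_into_trancl)
      then show ?case using step F[of x y] by (auto intro: trancl_into_trancl)
    qed
    then have "(z, u) \<in> (parcs F)\<^sup>+" using z(2) by blast
    moreover have "(u, v) \<in> parcs F"
      using uv by (simp add: F_def reorient_def)
    moreover have "(v, z) \<in> parcs F" using F z by blast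
    ultimately have "(z, z) \<in> (parcs F)\<^sup>+" by (meson trancl_into_trancl)
    then show False using acycF by (simp add: acyclic_def)
  qed
qed

text \<open>
  An arc \<open>(u, v)\<close> reversed by \<open>E\<close> is reversed by the join irreducible of some arc
  \<open>(b, a)\<close> reversed in the transitive reduction of \<open>E\<close> with \<open>b \<le> u\<close> and \<open>v \<le> a\<close> in \<open>D\<close>,
  unless some \<open>w\<close> between \<open>u\<close> and \<open>v\<close> in \<open>D\<close> splits it into two arcs reversed by \<open>E\<close>. Such an
  arc is found by taking \<open>(a, b)\<close> as close as possible in \<open>E\<close>.
\<close>

lemma reversed_arc_under_I_join:
  assumes E: "acyclic_reorientation D E" and uv: "(u, v) \<in> reversed_arcs D E"
    and unsplit: "\<nexists>w. (u, w) \<in> reversed_arcs D E \<and> (w, v) \<in> reversed_arcs D E"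
  obtains a b where "(b, a) \<in> parcs D" "(a, b) \<in> parcs (transitive_reduction E)"
    "(u, v) \<in> reversed_arcs D (I_join D (rope_of D E b a))"
proof -
  have acycE: "acyclic (parcs E)"
    using E by (simp add: acyclic_reorientation_iff)
  have "parcs E \<subseteq> parcs D \<union> (parcs D)\<inverse>"
    using E by (auto simp: acyclic_reorientation_iff)
  then have finE: "finite (parcs E)"
    using fin by (meson finite_UnI finite_converse finite_subset)
  note noE = acyclic_no_short_cycles[OF acycE]
  note flip = acyclic_reorientation_flip[OF E]
  note transE = acyclic_reorientation_trans[OF E]
  have D_uv: "(u, v) \<in> parcs D" and E_vu: "(v, u) \<in> parcs E"
    using uv flip by (auto simp: reversed_arcs_def)
  \<comment> \<open>\<open>S\<close> and \<open>L\<close> collect the candidates for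
    \<open>b\<close> and for \<open>a\<close>: besides \<open>u\<close> and \<open>v\<close>
    themselves, vertices between \<open>v\<close> and \<open>u\<close> in \<open>E\<close> that
    precede \<open>u\<close>, respectively follow \<open>v\<close>, in \<open>D\<close>.\<close>
  define S where "S = {w. w = u \<or> (w, u) \<in> parcs D \<and> (v, w) \<in> parcs E \<and> (w, u) \<in> parcs E}"
  define L where "L = {w. w = v \<or> (v, w) \<in> parcs D \<and> (v, w) \<in> parcs E \<and> (w, u) \<in> parcs E}"
  define P where "P = (\<lambda>(a, b). a \<in> L \<and> b \<in> S \<and> (a, b) \<in> parcs E)"
  have "P (v, u)" using E_vu by (simp add: P_def S_def L_def)
  then obtain ab where "P ab"
    and "\<And>ab'. P ab' \<Longrightarrow> card (between (parcs E) (fst ab) (snd ab)) \<le>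
      card (between (parcs E) (fst ab') (snd ab'))"
    using ex_has_least_nat[of P "(v, u)" "\<lambda>ab. card (between (parcs E) (fst ab) (snd ab))"] by blast
  then obtain a b where ab: "a \<in> L" "b \<in> S" "(a, b) \<in> parcs E"
    and least: "\<And>a' b'. a' \<in> L \<Longrightarrow> b' \<in> S \<Longrightarrow> (a', b') \<in> parcs E \<Longrightarrow>
      card (between (parcs E) a b) \<le> card (between (parcs E) a' b')"
    by (cases ab) (fastforce simp: P_def)
  have bu: "b = u \<or> (b, u) \<in> parcs D \<and> (v, b) \<in> parcs E \<and> (b, u) \<in> parcs E"
    using ab(2) by (simp add: S_def)
  have va: "a = v \<or> (v, a) \<in> parcs D \<and> (v, a) \<in> parcs E \<and> (a, u) \<in> parcs E"
    using ab(1) by (simp add: L_def)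
  have bv_tr: "(b, v) \<in> (parcs D)\<^sup>+" and ua_tr: "(u, a) \<in> (parcs D)\<^sup>+"
    using bu va D_uv by (auto intro: trancl_into_trancl)
  then have "(b, a) \<in> (parcs D)\<^sup>+"
    using va by (auto intro: trancl_into_trancl)
  then have "(a, b) \<notin> parcs D"
    using acyc by (auto simp: acyclic_def intro: trancl_into_trancl)
  then have D_ba: "(b, a) \<in> parcs D"
    using acyclic_reorientation_adj[OF E ab(3)] by blast
  have ua: "(u, a) \<in> parcs D"
    using bu D_ba interpolate[of b u a] ua_tr by blast
  have bv: "(b, v) \<in> parcs D"
    using va D_ba interpolate[of b v a] bv_tr by blast
  \<comment> \<open>A detour \<open>w\<close> would itself belong to \<open>L\<close> or
    \<open>S\<close>, and \<open>(w, b)\<close> or \<open>(a, w)\<close> would be a closer pair than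
    \<open>(a, b)\<close>.\<close>
  have "\<nexists>w. (a, w) \<in> parcs E \<and> (w, b) \<in> parcs E"
  proof
    assume "\<exists>w. (a, w) \<in> parcs E \<and> (w, b) \<in> parcs E"
    then obtain w where w: "(a, w) \<in> parcs E" "(w, b) \<in> parcs E" by blast
    have wa: "(w, a) \<in> parcs D \<or> (a, w) \<in> parcs D" and wb: "(w, b) \<in> parcs D \<or> (b, w) \<in> parcs D"
      using w acyclic_reorientation_adj[OF E] by blast+
    have E_vw: "(v, w) \<in> parcs E" if "(v, w) \<in> parcs D \<or> (w, v) \<in> parcs D"
      using va w(1) that transE[of v a w] by blast
    have E_wu: "(w, u) \<in> parcs E" if "(u, w) \<in> parcs D \<or> (w, u) \<in> parcs D"
      using bu w(2) that transE[of w b u] by blast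
    have wu: "w \<noteq> u" and wv: "w \<noteq> v"
      using bu va w noE(1,2) by metis+
    have "w \<in> L \<or> w \<in> S"
    proof -
      consider "(b, w) \<in> parcs D" "(w, a) \<in> parcs D" | "(w, b) \<in> parcs D" | "(a, w) \<in> parcs D"
        using wa wb by blast
      then show ?thesis
      proof cases
        case 1
        \<comment> \<open>\<open>u\<close>, \<open>v\<close> and \<open>w\<close> all lie in the
          interval of \<open>(b, a)\<close>, endpoints included, so the tournament property makes
          \<open>w\<close> adjacent to \<open>u\<close> and to \<open>v\<close>.\<close>
        have adj_u: "(u, w) \<in> parcs D \<or> (w, u) \<in> parcs D"
          using bu 1 interval_tournament[OF _ ua 1 D_ba] wu by blast
        have adj_v: "(v, w) \<in> parcs D \<or> (w, v) \<in> parcs D"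
          using va 1 interval_tournament[OF bv _ 1 D_ba] wv by blast
        \<comment> \<open>Otherwise \<open>w\<close> would split \<open>(u, v)\<close> into two
          reversed arcs. Hence \<open>w\<close> precedes \<open>u\<close> or follows
          \<open>v\<close> in \<open>D\<close>.\<close>
        have "\<not> ((u, w) \<in> parcs D \<and> (w, v) \<in> parcs D)"
          using unsplit E_wu[OF adj_u] E_vw[OF adj_v] flip by (auto simp: reversed_arcs_def)
        then show ?thesis
          using adj_u adj_v E_wu E_vw by (auto simp: S_def L_def)
      next
        case 2
        \<comment> \<open>Here \<open>w\<close> precedes \<open>b\<close> in \<open>D\<close>, and
          interpolation in the arc \<open>(w, a)\<close> gives arcs from \<open>w\<close> to
          \<open>u\<close> and \<open>v\<close>. The next case is symmetric.\<close>
        have "(a, w) \<notin> parcs D" using no_short_cycles(3)[OF D_ba, of w] 2 by blast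
        then have D_wa: "(w, a) \<in> parcs D" using wa by blast
        have "(w, u) \<in> (parcs D)\<^sup>+" "(w, v) \<in> (parcs D)\<^sup>+"
          using 2 bu bv by (auto intro: trancl_into_trancl)
        then have "(w, u) \<in> parcs D" "(w, v) \<in> parcs D"
          using interpolate[of w u a] interpolate[of w v a] D_wa ua va by blast+
        then show ?thesis using E_wu E_vw by (simp add: S_def)
      next
        case 3
        have "(w, b) \<notin> parcs D" using no_short_cycles(3)[OF D_ba 3] by blast
        then have D_bw: "(b, w) \<in> parcs D" using wb by blast
        have "(u, w) \<in> (parcs D)\<^sup>+" "(v, w) \<in> (parcs D)\<^sup>+"
          using 3 va ua by (auto intro: trancl_into_trancl)
        then have "(u, w) \<in> parcs D" "(v, w) \<in> parcs D"
          using interpolate[of b u w] interpolate[of b v w] D_bw bv bu by blast+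
        then show ?thesis using E_wu E_vw by (simp add: L_def)
      qed
    qed
    then show False
      using least[of a w] least[of w b] ab(1,2) w
        card_between_less[OF finE acycE r_into_trancl[OF w(1)] r_into_trancl[OF w(2)]]
      by linarith
  qed
  then have red: "(a, b) \<in> parcs (transitive_reduction E)"
    using transitive_reduction_iff_no_detour[OF E D_ba] ab(3) by blast
  have "u \<in> delta D E b a \<union> {b}"
    using bu va ua E_vu flip[OF ua] in_pverts[OF D_uv] by (auto simp: delta_def)
  moreover have "v \<in> nabla D E b a \<union> {a}"
    using bu va bv E_vu flip[OF bv] in_pverts[OF D_uv] by (auto simp: nabla_def)
  ultimately have "(u, v) \<in> reversed_arcs D (I_join D (rope_of D E b a))"
    unfolding rope_of_def reversed_arcs_I_join using D_uv by simp
  then show thesis using that D_ba red by blast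
qed

section \<open>The join and its canonicity\<close>

text \<open>Induction on the size of the interval in \<open>D\<close>. If an arc splits into two
  reversed arcs, these are reversed in \<open>F\<close> by induction and transitivity of
  \<open>F\<close> reverses the arc. Otherwise it is reversed by one of the joinands.\<close>

lemma reversed_arcs_least_upper:
  assumes E: "acyclic_reorientation D E" and F: "acyclic_reorientation D F"
    and upper: "\<And>u v. (u, v) \<in> parcs D \<Longrightarrow> (v, u) \<in> parcs (transitive_reduction E) \<Longrightarrow>
      reversed_arcs D (I_join D (rope_of D E u v)) \<subseteq> reversed_arcs D F"
  shows "reversed_arcs D E \<subseteq> reversed_arcs D F"
proof -
  have "(u, v) \<in> reversed_arcs D F" if "(u, v) \<in> reversed_arcs D E" for u v
    using that
  proof (induction "card (between (parcs D) u v)" arbitrary: u v rule: less_induct)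
    case less
    show ?case
    proof (cases "\<exists>w. (u, w) \<in> reversed_arcs D E \<and> (w, v) \<in> reversed_arcs D E")
      case True
      then obtain w where w: "(u, w) \<in> reversed_arcs D E" "(w, v) \<in> reversed_arcs D E" by blast
      then have "(u, w) \<in> (parcs D)\<^sup>+" "(w, v) \<in> (parcs D)\<^sup>+" by (auto simp: reversed_arcs_def)
      note card_between_less[OF fin acyc this]
      then have "(u, w) \<in> reversed_arcs D F" "(w, v) \<in> reversed_arcs D F"
        using less.hyps w by blast+
      then show ?thesis
        using less.prems acyclic_reorientation_trans[OF F, of u w v]
          acyclic_reorientation_trans[OF F, of v w u] acyclic_reorientation_flip[OF F] unfolding reversed_arcs_def by blast
    next
      case False
      then show ?thesis
        using reversed_arc_under_I_join[OF E less.prems] upper by blast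
    qed
  qed
  then show ?thesis by auto
qed

text \<open>For the joinand of an arc \<open>c\<close>, the separating element is
  \<open>F c\<close>, which reverses the same arcs as \<open>E\<close> except \<open>c\<close>. An
  element below \<open>E\<close> fails to lie below \<open>F c\<close> exactly when it reverses
  \<open>c\<close>, and then it lies above \<open>I c\<close>.\<close>

lemma canonical_join_representation_AR:
  assumes E: "acyclic_reorientation D E"
  shows "canonical_join_representation (AR D) E (I_join D ` delta_join D E)"
proof -
  define C where "C = {(u, v) \<in> parcs D. (v, u) \<in> parcs (transitive_reduction E)}"
  define I where "I = (\<lambda>(u, v). I_join D (rope_of D E u v))"
  define F where "F = (\<lambda>c. reorient D (reversed_arcs D E - {c}))"
  have J: "I_join D ` delta_join D E = I ` C"
    by (force simp: delta_join_def C_def I_def)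
  have C: "(u, v) \<in> parcs D" "(v, u) \<in> parcs E" "\<nexists>w. (v, w) \<in> parcs E \<and> (w, u) \<in> parcs E"
    if "(u, v) \<in> C" for u v
    using that transitive_reduction_iff_no_detour[OF E] by (auto simp: C_def)
  have C_rev: "c \<in> reversed_arcs D E" if "c \<in> C" for c
    using that C acyclic_reorientation_flip[OF E] by (cases c) (auto simp: reversed_arcs_def)
  have I: "acyclic_reorientation D (I c)" and F: "acyclic_reorientation D (F c)" if "c \<in> C" for c
    using I_join_acyclic[OF E C, of "fst c" "snd c"]
      unreverse_arc_acyclic[OF E C, of "fst c" "snd c"] that
    by (simp_all add: I_def F_def split_beta)
  have rev_F: "reversed_arcs D (F c) = reversed_arcs D E - {c}" for c
    unfolding F_def by (rule reversed_arcs_reorient) (auto simp: reversed_arcs_def)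
  have I_le: "reversed_arcs D (I c) \<subseteq> reversed_arcs D G"
    if "acyclic_reorientation D G" "reversed_arcs D G \<subseteq> reversed_arcs D E" "c \<in> reversed_arcs D G" for c G
    using reversed_arcs_I_join_le[OF E that(1,2), of "fst c" "snd c"] that(3) by (simp add: I_def split_beta)
  have le: "G \<sqsubseteq>\<^bsub>AR D\<^esub> G' \<longleftrightarrow> reversed_arcs D G \<subseteq> reversed_arcs D G'"
    and carrier: "G \<in> carrier (AR D) \<longleftrightarrow> acyclic_reorientation D G" for G G'
    by (simp_all add: AR_def)
  show ?thesis
    unfolding J
  proof (rule canonical_join_representationI)
    show sub: "I ` C \<subseteq> carrier (AR D)" using I by (auto simp: carrier)
    show "least (AR D) E (Upper (AR D) (I ` C))"
    proof (rule least_UpperI)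
      show "i \<sqsubseteq>\<^bsub>AR D\<^esub> E" if "i \<in> I ` C" for i
        using that I_le[OF E] C_rev by (auto simp: le)
      show "E \<sqsubseteq>\<^bsub>AR D\<^esub> G" if "G \<in> Upper (AR D) (I ` C)" for G
      proof -
        have G: "acyclic_reorientation D G" "\<And>c. c \<in> C \<Longrightarrow> I c \<sqsubseteq>\<^bsub>AR D\<^esub> G"
          using that sub by (auto simp: Upper_def carrier)
        show ?thesis
          unfolding le using G(2) by (intro reversed_arcs_least_upper[OF E G(1)]) (force simp: C_def I_def le)
      qed
    qed (use sub E in \<open>auto simp: carrier\<close>)
  next
    fix j assume "j \<in> I ` C"
    then obtain c where c: "c \<in> C" "j = I c" by blast
    show "\<exists>f\<in>carrier (AR D). \<not> E \<sqsubseteq>\<^bsub>AR D\<^esub> f \<and> (\<forall>i\<in>I ` C. i \<noteq> j \<longrightarrow> i \<sqsubseteq>\<^bsub>AR D\<^esub> f) \<and>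
      (\<forall>y\<in>carrier (AR D). y \<sqsubseteq>\<^bsub>AR D\<^esub> E \<longrightarrow> \<not> y \<sqsubseteq>\<^bsub>AR D\<^esub> f \<longrightarrow> j \<sqsubseteq>\<^bsub>AR D\<^esub> y)"
    proof (intro bexI[of _ "F c"] conjI ballI impI)
      show "F c \<in> carrier (AR D)" using F[OF c(1)] by (simp add: carrier)
      show "\<not> E \<sqsubseteq>\<^bsub>AR D\<^esub> F c" using C_rev[OF c(1)] by (auto simp: le rev_F)
      \<comment> \<open>\<open>F c\<close> still reverses the arc that defines \<open>i\<close>, so
        it lies above the least element doing so.\<close>
      show "i \<sqsubseteq>\<^bsub>AR D\<^esub> F c" if "i \<in> I ` C" "i \<noteq> j" for i
        using that c I_le[OF F[OF c(1)]] C_rev by (auto simp: le rev_F)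
      show "j \<sqsubseteq>\<^bsub>AR D\<^esub> y" if "y \<in> carrier (AR D)" "y \<sqsubseteq>\<^bsub>AR D\<^esub> E" "\<not> y \<sqsubseteq>\<^bsub>AR D\<^esub> F c" for y
        using that c I_le[of y c] by (auto simp: le rev_F carrier)
    qed
  qed
qed

end


section \<open>Duality\<close>

text \<open>Since reorientations are stored as digraphs, \<open>D\<close> and its opposite have the
  same ones. Only the sets of reversed arcs are complemented, up to direction, which turns the order
  around.\<close>

definition opposite :: "'a pair_pre_digraph \<Rightarrow> 'a pair_pre_digraph" where
  "opposite D = \<lparr> pverts = pverts D, parcs = (parcs D)\<inverse> \<rparr>"

lemma opposite_simps [simp]:
  "pverts (opposite D) = pverts D" "parcs (opposite D) = (parcs D)\<inverse>"
  by (simp_all add: opposite_def)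

lemma acyclic_reorientation_opposite:
  "acyclic_reorientation (opposite D) E \<longleftrightarrow> acyclic_reorientation D E"
  by (simp add: acyclic_reorientation_iff Un_commute[of "(parcs D)\<inverse>" "parcs D"])

lemma skeletal_dag_opposite:
  assumes "skeletal_dag D"
  shows "skeletal_dag (opposite D)"
proof -
  interpret skeletal_dag D by fact
  show ?thesis
  proof (rule skeletal_dag.intro)
    show "pair_wf_digraph (opposite D)"
      using in_pverts by unfold_locales auto
    show "finite (parcs (opposite D))" "acyclic (parcs (opposite D))"
      using fin acyc by (simp_all add: acyclic_converse)
    show "(x, y) \<in> parcs (opposite D) \<and> (y, z) \<in> parcs (opposite D)"
      if "(x, y) \<in> (parcs (opposite D))\<^sup>+" "(y, z) \<in> (parcs (opposite D))\<^sup>+"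
        "(x, z) \<in> parcs (opposite D)" for x y z
      using that interpolate[of z y x] by (simp add: trancl_converse)
    show "(w, w') \<in> parcs (opposite D) \<or> (w', w) \<in> parcs (opposite D)"
      if "(a, w) \<in> parcs (opposite D)" "(w, b) \<in> parcs (opposite D)"
        "(a, w') \<in> parcs (opposite D)" "(w', b) \<in> parcs (opposite D)"
        "(a, b) \<in> parcs (opposite D)" "w \<noteq> w'" for a b w w'
      using that interval_tournament[of b w a w'] by auto
    show "acyclic B"
      if "B \<union> B\<inverse> = parcs (opposite D) \<union> (parcs (opposite D))\<inverse>" "B \<inter> B\<inverse> = {}"
        "\<And>x y z. (x, y) \<in> B \<Longrightarrow> (y, z) \<in> B \<Longrightarrow> (z, x) \<notin> B" for B
    proof (rule orientation_acyclic)
      show "B \<union> B\<inverse> = parcs D \<union> (parcs D)\<inverse>"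
        using that(1) by (simp add: Un_commute[of "(parcs D)\<inverse>" "parcs D"])
    qed (fact that)+
  qed
qed

lemma reversed_arcs_opposite:
  assumes E: "acyclic_reorientation D E"
  shows "reversed_arcs (opposite D) E = (parcs D - reversed_arcs D E)\<inverse>"
proof (rule Set.set_eqI)
  fix e :: "'a \<times> 'a"
  show "e \<in> reversed_arcs (opposite D) E \<longleftrightarrow> e \<in> (parcs D - reversed_arcs D E)\<inverse>"
    using acyclic_reorientation_flip[OF E, of "snd e" "fst e"]
    by (cases e) (simp add: reversed_arcs_def, blast)
qed

lemma reversed_arcs_opposite_subset:
  assumes E: "acyclic_reorientation D E" and F: "acyclic_reorientation D F"
  shows "reversed_arcs (opposite D) E \<subseteq> reversed_arcs (opposite D) F \<longleftrightarrow>
    reversed_arcs D F \<subseteq> reversed_arcs D E"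
proof -
  have "reversed_arcs D E \<subseteq> parcs D" "reversed_arcs D F \<subseteq> parcs D"
    by (auto simp: reversed_arcs_def)
  then show ?thesis
    unfolding reversed_arcs_opposite[OF E] reversed_arcs_opposite[OF F] converse_mono by blast
qed

text \<open>The opposite exchanges the two arcs at \<open>w\<close> and also exchanges reversed with
  unreversed. The two changes cancel, so only the endpoints of the rope are swapped.\<close>

lemma rope_of_opposite:
  assumes E: "acyclic_reorientation D E"
  shows "rope_of (opposite D) E v u = (v, u, nabla D E u v, delta D E u v)"
proof -
  have "nabla (opposite D) E v u = nabla D E u v"
    using acyclic_reorientation_flip[OF E] unfolding nabla_def opposite_simps by blast
  moreover have "delta (opposite D) E v u = delta D E u v"
    using acyclic_reorientation_flip[OF E] unfolding delta_def opposite_simps by blast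
  ultimately show ?thesis by (simp add: rope_of_def)
qed

text \<open>Being reversed with respect to the opposite digraph means pointing as in
  \<open>D\<close>.\<close>

lemma I_join_opposite: "I_join (opposite D) (v, u, N, T) = I_meet D (u, v, N, T)"
  by (auto simp: reorient_def)

lemma I_join_delta_join_opposite:
  assumes E: "acyclic_reorientation D E"
  shows "I_join (opposite D) ` delta_join (opposite D) E = I_meet D ` delta_meet D E"
proof -
  have "I_join (opposite D) ` delta_join (opposite D) E =
    {I_join (opposite D) (rope_of (opposite D) E v u) | u v.
      (u, v) \<in> parcs D \<and> (u, v) \<in> parcs (transitive_reduction E)}"
    unfolding delta_join_def opposite_simps converse_iff by blast
  also have "\<dots> = {I_meet D (rope_of D E u v) | u v.
      (u, v) \<in> parcs D \<and> (u, v) \<in> parcs (transitive_reduction E)}"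
    unfolding rope_of_opposite[OF E] I_join_opposite by (simp add: rope_of_def)
  also have "\<dots> = I_meet D ` delta_meet D E"
    unfolding delta_meet_def by blast
  finally show ?thesis .
qed

theorem corollary30:
  fixes D E :: "'a pair_pre_digraph"
  assumes "pair_digraph D" and "acyclic (parcs D)" and "skeletal D"
    and "acyclic_reorientation D E"
  shows "canonical_join_representation (AR D) E (I_join D ` delta_join D E) \<and>
    canonical_meet_representation (AR D) E (I_meet D ` delta_meet D E)"
proof
  have fin: "pair_fin_digraph D" and wf: "pair_wf_digraph D"
    using assms(1) by (simp_all add: pair_digraph_def pair_fin_digraph_def)
  have D: "skeletal_dag D"
  proof (rule skeletal_dag.intro)
    show "pair_wf_digraph D" "acyclic (parcs D)" by fact+
    show "finite (parcs D)" using fin by (rule pair_fin_digraph.pair_finite_arcs)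
  next
    show "(x, y) \<in> parcs D \<and> (y, z) \<in> parcs D"
      if "(x, y) \<in> (parcs D)\<^sup>+" "(y, z) \<in> (parcs D)\<^sup>+" "(x, z) \<in> parcs D" for x y z
      using filled_interpolate[OF wf assms(2) _ that] assms(3) by (simp add: skeletal_def)
  next
    show "(w, w') \<in> parcs D \<or> (w', w) \<in> parcs D"
      if "(a, w) \<in> parcs D" "(w, b) \<in> parcs D" "(a, w') \<in> parcs D" "(w', b) \<in> parcs D"
        "(a, b) \<in> parcs D" "w \<noteq> w'" for a b w w'
      using skeletal_interval_tournament[OF wf assms(2,3) that(5,1-4,6)] .
  next
    show "acyclic B"
      if "B \<union> B\<inverse> = parcs D \<union> (parcs D)\<inverse>" "B \<inter> B\<inverse> = {}"
        "\<And>x y z. (x, y) \<in> B \<Longrightarrow> (y, z) \<in> B \<Longrightarrow> (z, x) \<notin> B" for B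
      using skeletal_orientation_acyclic[OF wf assms(2,3) that] .
  qed
  show "canonical_join_representation (AR D) E (I_join D ` delta_join D E)"
    using skeletal_dag.canonical_join_representation_AR[OF D assms(4)] .
  \<comment> \<open>The result on joins in the opposite digraph has the meetands of \<open>D\<close>
    as its joinands.\<close>
  have "canonical_join_representation (AR (opposite D)) E (I_meet D ` delta_meet D E)"
    using skeletal_dag.canonical_join_representation_AR[OF skeletal_dag_opposite[OF D]] assms(4)
    by (simp add: acyclic_reorientation_opposite I_join_delta_join_opposite)
  then have "canonical_join_representation (inv_gorder (AR D)) E (I_meet D ` delta_meet D E)"
    by (subst canonical_join_representation_cong[of _ "AR (opposite D)"])
      (auto simp: AR_def acyclic_reorientation_opposite reversed_arcs_opposite_subset)
  then show "canonical_meet_representation (AR D) E (I_meet D ` delta_meet D E)"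
    by (simp add: canonical_meet_representation_def)
qed

end
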